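(* Consider a given starting state $q_0\in Q$ and a sequence of errors $\{\epsilon_k\}_k$, with $\epsilon_k\in\mathcal{E}_k$. Moreover, assume that the intermediate variables $z_k=z_k(\tilde\theta)+\epsilon_k$ in the solver automaton generate the solver-state sequence $\mathbb{Q}=\{\tilde q_k\}_k$, where $\tilde\theta\in\Theta_0$. Then, if the certification procedure with lift-partition-project step (with $\mathcal{E}=\mathcal{E}_k$) is started with $q_0$ and $\Theta_0$, there exists a tuple $(\Theta^i,\{q^i_k\}_k)$ in the final partition $\mathcal{F}$ generated by the procedure such that $\tilde\theta\in\Theta^i$ and $\tilde q_k=q^i_k$ for all $k$.
   Context: Data. $Q$ is a set of solver states, some of which mark termination; $\Theta_0\subseteq\mathbb{R}^{n_\theta}$ is a polyhedron of parameters. Each $q\in Q$ determines: a dimension $n_z(q)$; a family of polyhedra $\mathcal{Z}^i=\{z: A^iz\le b^i\}$, $i=1,\dots,N$ (with $A^i,b^i,N$ depending on $q$), that partitions $\mathbb{R}^{n_z(q)}$, meaning that distinct members have disjoint interiors and $\bigcup_i\mathcal{Z}^i=\mathbb{R}^{n_z(q)}$; and an affine map $z(\theta)=F_q\theta+g_q\in\mathbb{R}^{n_z(q)}$ (the intermediate variable). There is a transition function $\delta:Q\times\mathbb{Z}\to Q$. When the current state at iteration $k$ is $q_k$, $z_k(\theta)$ denotes $F_{q_k}\theta+g_{q_k}$. Solver automaton. Given the starting state $q_0$, start with $k=0$ and the empty sequence $\mathbb{Q}$, and repeat: append $q_k$ to $\mathbb{Q}$; generate the polyhedra $\{z:A^iz\le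 b^i\}_i$ and the vector $z_k$ based on $q_k$; find $i$ such that $A^iz_k\le b^i$; set $q_{k+1}=\delta(q_k,i)$; increase $k$ by one; until $q_k$ marks termination. Then return $\mathbb{Q}$, the solver-state sequence. Errors. $\mathcal{E}_k$ is the set modelling the possible numerical errors $\epsilon_k$ in the intermediate variable at iteration $k$; its elements have the dimension of the intermediate variable. Certification procedure with lift-partition-project step. Input $\Theta_0,q_0$. Initialize a stack $S$ containing only $(\Theta_0,q_0,\emptyset)$, where $\emptyset$ is the empty sequence, and $\mathcal{F}=\emptyset$. While $S\ne\emptyset$: pop a tuple $(\Theta,q,\mathbb{Q})$ from $S$; append $q$ to $\mathbb{Q}$; generate the polyhedra $\{z:A^iz\le b^i\}_{i=1}^N$ and the map $z(\theta)$ based on $q$; with $\mathcal{E}=\mathcal{E}_k$, where $k$ is the iteration number of the tuple (the number of state updates made from $q_0$ to reach it), lift $\Theta$ to $\Psi=\Theta\times\mathcal{E}$, form for each $i$ the set $\Psi^i=\{(\theta,\epsilon)\in\Theta\times\mathcal{E}: A^i(z(\theta)+\epsilon)\le b^i\}$, and project it to $\tilde\Theta^i=\{\theta\in\Theta:\exists\,\epsilon\in\mathcal{E},\ (\theta,\epsilon)\in\Psi^i\}$; for each $i$ with $\tilde\Theta^i\ne\emptyset$, set $q^i=\delta(q,i)$, and if $q^i$ marks termination push $(\tilde\Theta^i,\mathbb{Q})$ to $\mathcal{F}$, otherwise push $(\tilde\Theta^i,q^i,\mathbb{Q})$ to $S$. When $S$ is empty, return $\mathcal{F}$, called the final partition.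 *)

theory Defs
  imports
    "HOL-Analysis.Abstract_Euclidean_Space"
    "HOL-Library.While_Combinator"
    "Jordan_Normal_Form.Matrix"
begin

text \<open>
  Vectors and matrices of varying dimension are those of \<^theory>\<open>Jordan_Normal_Form.Matrix\<close>; there
  \<open>u \<le> v\<close> means that \<open>u\<close> and \<open>v\<close> have the same dimension and are ordered componentwise.
\<close>

definition half_space_set :: "nat \<Rightarrow> real mat \<Rightarrow> real vec \<Rightarrow> real vec set" where
  "half_space_set n A b = {z \<in> carrier_vec n. A *\<^sub>v z \<le> b}"

definition is_polyhedron :: "nat \<Rightarrow> real vec set \<Rightarrow> bool" where
  "is_polyhedron n P \<longleftrightarrow>
     (\<exists>A b. A \<in> carrier_mat (dim_vec b) n \<and> P = half_space_set n A b)"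

text \<open>
  The type of vectors of all dimensions carries no topology. The interior of a subset of
  $R^n$ is therefore taken in the library's space \<^const>\<open>Euclidean_space\<close>, whose
  points are the sequences that vanish from index \<open>n\<close> on.
\<close>

definition vec_to_seq :: "real vec \<Rightarrow> nat \<Rightarrow> real" where
  "vec_to_seq v = (\<lambda>i. if i < dim_vec v then v $ i else 0)"

definition vec_interior :: "nat \<Rightarrow> real vec set \<Rightarrow> real vec set" where
  "vec_interior n X =
     {v \<in> carrier_vec n. vec_to_seq v \<in> Euclidean_space n interior_of (vec_to_seq ` X)}"

definition partitions_space :: "nat \<Rightarrow> real vec set set \<Rightarrow> bool" where
  "partitions_space n \<Z> \<longleftrightarrow>
     \<Union>\<Z> = carrier_vec n \<and>
     pairwise (\<lambda>X Y. vec_interior n X \<inter> vec_interior n Y = {}) \<Z>"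

text \<open>
  The polyhedra of a state \<open>q\<close> are indexed by \<open>1, \<dots>, num_polys S q\<close>, and the \<open>i\<close>-th one is
  given by \<open>poly_mat S q i\<close> and \<open>poly_rhs S q i\<close>. The intermediate variable of \<open>q\<close> is
  \<open>aff_mat S q *\<^sub>v \<theta> + aff_vec S q\<close>.
\<close>

record 'q solver =
  states :: "'q set"
  final_states :: "'q set"
  param_dim :: nat
  z_dim :: "'q \<Rightarrow> nat"
  num_polys :: "'q \<Rightarrow> nat"
  poly_mat :: "'q \<Rightarrow> nat \<Rightarrow> real mat"
  poly_rhs :: "'q \<Rightarrow> nat \<Rightarrow> real vec"
  aff_mat :: "'q \<Rightarrow> real mat"
  aff_vec :: "'q \<Rightarrow> real vec"
  trans_fun :: "'q \<Rightarrow> int \<Rightarrow> 'q"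

definition poly_set :: "'q solver \<Rightarrow> 'q \<Rightarrow> nat \<Rightarrow> real vec set" where
  "poly_set S q i = half_space_set (z_dim S q) (poly_mat S q i) (poly_rhs S q i)"

definition z_map :: "'q solver \<Rightarrow> 'q \<Rightarrow> real vec \<Rightarrow> real vec" where
  "z_map S q \<theta> = aff_mat S q *\<^sub>v \<theta> + aff_vec S q"

definition solver_data :: "'q solver \<Rightarrow> bool" where
  "solver_data S \<longleftrightarrow>
     final_states S \<subseteq> states S \<and>
     (\<forall>q\<in>states S.
        (\<forall>i\<in>{1..num_polys S q}.
           poly_mat S q i \<in> carrier_mat (dim_vec (poly_rhs S q i)) (z_dim S q)) \<and>
        partitions_space (z_dim S q) (poly_set S q ` {1..num_polys S q}) \<and>
        aff_mat S q \<in> carrier_mat (z_dim S q) (param_dim S) \<and>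
        aff_vec S q \<in> carrier_vec (z_dim S q) \<and>
        (\<forall>i. trans_fun S q i \<in> states S))"

text \<open>
  \<open>solver_loop S zv k q qs rs\<close>: from iteration \<open>k\<close> with current state \<open>q\<close> and sequence \<open>qs\<close>
  collected so far, the repeat loop can end and return \<open>rs\<close>, where \<open>zv k q\<close> is the
  intermediate variable used in iteration \<open>k\<close> when the state is \<open>q\<close>. The choice of \<open>i\<close> is
  nondeterministic because boundary points lie in several polyhedra. Termination is tested
  only after the state update, so the body is executed at least once and the terminating
  state itself is not part of the returned sequence.
\<close>

inductive solver_loop ::
  "'q solver \<Rightarrow> (nat \<Rightarrow> 'q \<Rightarrow> real vec) \<Rightarrow> nat \<Rightarrow> 'q \<Rightarrow> 'q list \<Rightarrow> 'q list \<Rightarrow> bool"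
  for S zv where
  stop: "\<lbrakk>i \<in> {1..num_polys S q}; zv k q \<in> poly_set S q i;
          trans_fun S q (int i) \<in> final_states S\<rbrakk>
         \<Longrightarrow> solver_loop S zv k q qs (qs @ [q])"
| continue: "\<lbrakk>i \<in> {1..num_polys S q}; zv k q \<in> poly_set S q i;
          trans_fun S q (int i) \<notin> final_states S;
          solver_loop S zv (Suc k) (trans_fun S q (int i)) (qs @ [q]) rs\<rbrakk>
         \<Longrightarrow> solver_loop S zv k q qs rs"

definition solver_generates ::
  "'q solver \<Rightarrow> (nat \<Rightarrow> 'q \<Rightarrow> real vec) \<Rightarrow> 'q \<Rightarrow> 'q list \<Rightarrow> bool" where
  "solver_generates S zv q\<^sub>0 rs \<longleftrightarrow> solver_loop S zv 0 q\<^sub>0 [] rs"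

text \<open>
  States met in the same iteration may have intermediate variables of different dimensions;
  at the state \<open>q\<close> the errors are the elements of \<open>\<E> k\<close> of the dimension of its
  intermediate variable.
\<close>

definition error_set :: "'q solver \<Rightarrow> (nat \<Rightarrow> real vec set) \<Rightarrow> nat \<Rightarrow> 'q \<Rightarrow> real vec set" where
  "error_set S \<E> k q = \<E> k \<inter> carrier_vec (z_dim S q)"

definition lifted_part ::
  "'q solver \<Rightarrow> 'q \<Rightarrow> real vec set \<Rightarrow> real vec set \<Rightarrow> nat \<Rightarrow> (real vec \<times> real vec) set" where
  "lifted_part S q E \<Theta> i = {(\<theta>, \<epsilon>) \<in> \<Theta> \<times> E. poly_mat S q i *\<^sub>v (z_map S q \<theta> + \<epsilon>) \<le> poly_rhs S q i}"

definition projected_part ::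
  "'q solver \<Rightarrow> 'q \<Rightarrow> real vec set \<Rightarrow> real vec set \<Rightarrow> nat \<Rightarrow> real vec set" where
  "projected_part S q E \<Theta> i = {\<theta> \<in> \<Theta>. \<exists>\<epsilon>\<in>E. (\<theta>, \<epsilon>) \<in> lifted_part S q E \<Theta> i}"

type_synonym 'q stack = "(real vec set \<times> 'q \<times> 'q list) list"
type_synonym 'q partition = "(real vec set \<times> 'q list) set"

definition push_part ::
  "'q solver \<Rightarrow> 'q \<Rightarrow> real vec set \<Rightarrow> real vec set \<Rightarrow> 'q list \<Rightarrow> nat
     \<Rightarrow> 'q stack \<times> 'q partition \<Rightarrow> 'q stack \<times> 'q partition" where
  "push_part S q E \<Theta> qs i = (\<lambda>(st, \<F>).
     let \<Theta>\<^sub>i = projected_part S q E \<Theta> i; q\<^sub>i = trans_fun S q (int i) in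
     if \<Theta>\<^sub>i = {} then (st, \<F>)
     else if q\<^sub>i \<in> final_states S then (st, insert (\<Theta>\<^sub>i, qs) \<F>)
     else ((\<Theta>\<^sub>i, q\<^sub>i, qs) # st, \<F>))"

text \<open>
  Every state update appends one element to the sequence stored in a tuple, so the
  iteration number of a popped tuple is the length of its sequence \<open>qs\<close>.
\<close>

fun certification_step ::
  "'q solver \<Rightarrow> (nat \<Rightarrow> real vec set) \<Rightarrow> 'q stack \<times> 'q partition \<Rightarrow> 'q stack \<times> 'q partition" where
  "certification_step S \<E> ([], \<F>) = ([], \<F>)"
| "certification_step S \<E> ((\<Theta>, q, qs) # st, \<F>) =
     fold (push_part S q (error_set S \<E> (length qs) q) \<Theta> (qs @ [q]))
       [1..<Suc (num_polys S q)] (st, \<F>)"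

text \<open>The result is \<^const>\<open>None\<close> exactly if the stack never becomes empty.\<close>

definition certification ::
  "'q solver \<Rightarrow> (nat \<Rightarrow> real vec set) \<Rightarrow> real vec set \<Rightarrow> 'q \<Rightarrow> 'q partition option" where
  "certification S \<E> \<Theta>\<^sub>0 q\<^sub>0 =
     map_option snd
       (while_option (\<lambda>(st, \<F>). st \<noteq> []) (certification_step S \<E>) ([(\<Theta>\<^sub>0, q\<^sub>0, [])], {}))"

end

theory Submission
  imports Defs
begin

text \<open>
  The main loop of the certification procedure keeps the following invariant: either
  \<open>\<F>\<close> already contains \<open>(\<Theta>, qs)\<close> for some \<open>\<Theta>\<close> containing \<open>\<theta>\<close>, or some stack entry contains
  \<open>\<theta>\<close> and the solver, resumed at its state, can still return \<open>qs\<close>. When such an entry is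
  popped, the next error of the run witnesses that \<open>\<theta>\<close> lies in the projected part of the
  index chosen by the solver, so a pushed tuple takes over its role.
\<close>

text \<open>Both rules append the current state before anything else happens. This places
  \<open>q\<close> at position \<open>length ps\<close> of \<open>rs\<close>, where the assumption
  on the errors can be applied.\<close>

lemma solver_loop_prefix:
  "solver_loop S zv k q ps rs \<Longrightarrow> \<exists>ts. rs = ps @ q # ts"
  by (induction rule: solver_loop.induct) auto

lemma push_part_mono:
  "set (fst s) \<subseteq> set (fst (push_part S q E \<Theta> ps i s))"
  "snd s \<subseteq> snd (push_part S q E \<Theta> ps i s)"
  by (auto simp: push_part_def Let_def split: prod.splits)

lemma fold_push_part_mono:
  "set (fst s) \<subseteq> set (fst (fold (push_part S q E \<Theta> ps) is s)) \<and>
   snd s \<subseteq> snd (fold (push_part S q E \<Theta> ps) is s)"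
proof (induction "is" arbitrary: s)
  case (Cons i "is")
  show ?case
    using Cons[of "push_part S q E \<Theta> ps i s"] push_part_mono[of s S q E \<Theta> ps i] by auto
qed simp

text \<open>The point \<theta> makes the part of index \<open>i\<close> nonempty, so
  \<open>push_part\<close> does not discard it. Indices treated earlier only change the start value
  \<open>s\<close>, which is arbitrary; later ones remove nothing.\<close>

lemma fold_push_part_pushes:
  assumes "i \<in> set is" and "\<theta> \<in> projected_part S q E \<Theta> i"
  shows "if trans_fun S q (int i) \<in> final_states S
    then (projected_part S q E \<Theta> i, ps) \<in> snd (fold (push_part S q E \<Theta> ps) is s)
    else (projected_part S q E \<Theta> i, trans_fun S q (int i), ps)
           \<in> set (fst (fold (push_part S q E \<Theta> ps) is s))"
  using assms(1)
proof (induction "is" arbitrary: s)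
  case (Cons j "is")
  show ?case
  proof (cases "i \<in> set is")
    case True
    then show ?thesis using Cons.IH by simp
  next
    case False
    then have "j = i" using Cons.prems by simp
    moreover have "if trans_fun S q (int i) \<in> final_states S
      then (projected_part S q E \<Theta> i, ps) \<in> snd (push_part S q E \<Theta> ps i s)
      else (projected_part S q E \<Theta> i, trans_fun S q (int i), ps)
             \<in> set (fst (push_part S q E \<Theta> ps i s))"
      using assms(2) by (auto simp: push_part_def Let_def split: prod.splits)
    ultimately show ?thesis
      using fold_push_part_mono[of "push_part S q E \<Theta> ps i s" S q E \<Theta> ps "is"]
      by (auto split: if_splits)
  qed
qed simp

text \<open>Resuming the run at iteration \<open>length ps\<close> lets it meet the same error set
  that \<open>certification_step\<close> uses for this tuple.\<close>

definition tracks ::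
  "'q solver \<Rightarrow> (nat \<Rightarrow> 'q \<Rightarrow> real vec) \<Rightarrow> real vec \<Rightarrow> 'q list \<Rightarrow> 'q stack \<times> 'q partition \<Rightarrow> bool"
  where
  "tracks S zv \<theta> rs s \<longleftrightarrow>
     (\<exists>\<Theta>. (\<Theta>, rs) \<in> snd s \<and> \<theta> \<in> \<Theta>) \<or>
     (\<exists>\<Theta> q ps. (\<Theta>, q, ps) \<in> set (fst s) \<and> \<theta> \<in> \<Theta> \<and> solver_loop S zv (length ps) q ps rs)"

lemma tracks_mono:
  assumes "tracks S zv \<theta> rs s" and "set (fst s) \<subseteq> set (fst s')" and "snd s \<subseteq> snd s'"
  shows "tracks S zv \<theta> rs s'"
  using assms unfolding tracks_def by blast

lemma projected_partI:
  assumes "\<theta> \<in> \<Theta>" and "e \<in> E" and "z_map S q \<theta> + e \<in> poly_set S q i"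
  shows "\<theta> \<in> projected_part S q E \<Theta> i"
  using assms by (auto simp: projected_part_def lifted_part_def poly_set_def half_space_set_def)

lemma tracks_certification_step:
  fixes S :: "'q solver" and \<epsilon> :: "nat \<Rightarrow> real vec"
  defines "zv \<equiv> \<lambda>\<theta> k q. z_map S q \<theta> + \<epsilon> k"
  assumes errors: "\<And>k. k < length rs \<Longrightarrow> \<epsilon> k \<in> error_set S \<E> k (rs ! k)"
    and "tracks S (zv \<theta>) \<theta> rs s"
  shows "tracks S (zv \<theta>) \<theta> rs (certification_step S \<E> s)"
proof (cases "fst s = []")
  case True
  then show ?thesis using assms(3) by (cases s) simp
next
  case False
  then obtain \<Theta> q ps st \<F> where s: "s = ((\<Theta>, q, ps) # st, \<F>)"
    by (cases s, cases "fst s") auto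
  define E where "E = error_set S \<E> (length ps) q"
  define s' where "s' = fold (push_part S q E \<Theta> (ps @ [q])) [1..<Suc (num_polys S q)] (st, \<F>)"
  have step: "certification_step S \<E> s = s'"
    by (simp add: s s'_def E_def)
  consider "tracks S (zv \<theta>) \<theta> rs (st, \<F>)"
    | "\<theta> \<in> \<Theta>" "solver_loop S (zv \<theta>) (length ps) q ps rs"
    using assms(3) unfolding s tracks_def by auto
  then show ?thesis
  proof cases
    case 1
    \<comment> \<open>The tracking tuple is not the popped one, and the fold only adds to the stack
      and the partition.\<close>
    then show ?thesis
      unfolding step s'_def
      using fold_push_part_mono[of "(st, \<F>)"] by (blast intro: tracks_mono)
  next
    case 2
    obtain ts where "rs = ps @ q # ts"
      using solver_loop_prefix[OF 2(2)] by blast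
    \<comment> \<open>Here \<open>rs ! length ps = q\<close> and
      \<open>length ps < length rs\<close>.\<close>
    then have "\<epsilon> (length ps) \<in> E"
      using errors[of "length ps"] by (simp add: E_def)
    \<comment> \<open>Stated for every admissible \<open>i\<close>, since the choice made by the run
      appears only on inverting \<open>solver_loop\<close> below.\<close>
    then have proj: "\<theta> \<in> projected_part S q E \<Theta> i"
      if "zv \<theta> (length ps) q \<in> poly_set S q i" for i
      using 2(1) that by (auto simp: zv_def intro: projected_partI)
    have pushed: "if trans_fun S q (int i) \<in> final_states S
        then (projected_part S q E \<Theta> i, ps @ [q]) \<in> snd s'
        else (projected_part S q E \<Theta> i, trans_fun S q (int i), ps @ [q]) \<in> set (fst s')"
      if "i \<in> {1..num_polys S q}" and "zv \<theta> (length ps) q \<in> poly_set S q i" for i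
      unfolding s'_def using that by (intro fold_push_part_pushes[OF _ proj]) auto
    from 2(2) show ?thesis
    proof cases
      case (stop i)
      \<comment> \<open>Stopping forces \<open>rs = ps @ [q]\<close>, which is exactly the sequence
        stored in the partition.\<close>
      then show ?thesis
        using pushed[of i] proj[of i] unfolding step tracks_def by auto
    next
      case (continue i)
      then have "(projected_part S q E \<Theta> i, trans_fun S q (int i), ps @ [q]) \<in> set (fst s')"
        using pushed[of i] by simp
      moreover have "solver_loop S (zv \<theta>) (length (ps @ [q])) (trans_fun S q (int i)) (ps @ [q]) rs"
        using continue by simp
      ultimately show ?thesis
        using proj[of i] continue unfolding step tracks_def by blast
    qed
  qed
qed

theorem theorem2:
  fixes S :: "'q solver"
    and \<Theta>\<^sub>0 :: "real vec set"
    and \<E> :: "nat \<Rightarrow> real vec set"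
    and \<epsilon> :: "nat \<Rightarrow> real vec"
    and \<theta> :: "real vec"
    and q\<^sub>0 :: 'q
    and qs :: "'q list"
    and \<F> :: "'q partition"
  assumes "solver_data S"
    and "is_polyhedron (param_dim S) \<Theta>\<^sub>0"
    and "q\<^sub>0 \<in> states S"
    and "\<theta> \<in> \<Theta>\<^sub>0"
    and "solver_generates S (\<lambda>k q. z_map S q \<theta> + \<epsilon> k) q\<^sub>0 qs"
    and "\<And>k. k < length qs \<Longrightarrow> \<epsilon> k \<in> error_set S \<E> k (qs ! k)"
    and "certification S \<E> \<Theta>\<^sub>0 q\<^sub>0 = Some \<F>"
  shows "\<exists>\<Theta>' qs'. (\<Theta>', qs') \<in> \<F> \<and> \<theta> \<in> \<Theta>' \<and>
           length qs' = length qs \<and> (\<forall>k < length qs. qs ! k = qs' ! k)"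
proof -
  let ?zv = "\<lambda>k q. z_map S q \<theta> + \<epsilon> k"
  obtain st where loop: "while_option (\<lambda>(st, \<F>). st \<noteq> []) (certification_step S \<E>)
      ([(\<Theta>\<^sub>0, q\<^sub>0, [])], {}) = Some (st, \<F>)"
    using assms(7) by (auto simp: certification_def)
  have "tracks S ?zv \<theta> qs ([(\<Theta>\<^sub>0, q\<^sub>0, [])], {})"
    using assms(4,5) by (simp add: tracks_def solver_generates_def)
  then have "tracks S ?zv \<theta> qs (st, \<F>)"
    using while_option_rule[where P = "tracks S ?zv \<theta> qs", OF _ loop]
      tracks_certification_step[OF assms(6)] by blast
  moreover have "st = []"
    using while_option_stop[OF loop] by simp
  \<comment> \<open>An empty stack leaves only the first alternative of \<open>tracks\<close>, so
    the sequence found is \<open>qs\<close> itself.\<close>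
  ultimately show ?thesis
    by (auto simp: tracks_def)
qed

end
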